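(* Let $(\mathfrak{g},g,J_g)$ and $(\mathfrak{h},h,J_h)$ be pseudo-Kähler Lie algebras and let $\varphi:\mathfrak{h}\to\mathrm{Der}(\mathfrak{g})$ be a representation such that $J_g\circ\varphi(A)^s=\varphi(J_hA)^s$ and $J_g\circ\varphi(A)^a=\varphi(A)^a\circ J_g$ for all $A\in\mathfrak{h}$. Let $\tilde{\mathfrak{g}}=\mathfrak{g}\rtimes_\varphi\mathfrak{h}$ with $\tilde g=g\oplus h$, $\tilde J=J_g\oplus J_h$, and let $$\tilde E=\begin{pmatrix}E_1&E_2\\ E_3&E_4\end{pmatrix}\in\mathrm{End}(\tilde{\mathfrak{g}}),\quad E_1\in\mathrm{End}(\mathfrak{g}),\ E_2\in\mathrm{Hom}(\mathfrak{h},\mathfrak{g}),\ E_3\in\mathrm{Hom}(\mathfrak{g},\mathfrak{h}),\ E_4\in\mathrm{End}(\mathfrak{h}).$$ Suppose that $(\tilde g,\tilde J,\tilde E)$ is an almost hypersymplectic structure on $\tilde{\mathfrak{g}}$. Then $(\tilde{\mathfrak{g}},\tilde g,\tilde J,\tilde E)$ is a hypersymplectic Lie algebra if and only if for all $X,Y,Z\in\mathfrak{g}$ and $A,B,C\in\mathfrak{h}$: \begin{itemize} \item $\nabla^hE_4=0$, \item $\varphi(A)^a\circ E_2=E_2\circ\nabla^h_A$, \item $\varphi(A)^a\circ E_1=E_1\circ\varphi(A)^a$, \item $\varphi(B)^sE_2C=\varphi(C)^sE_2B$, \item $g(\nabla^g_XY,E_2C)=g\big((E_1\circ\varphi(C)^s-\varphi(E_4C)^s)X,Y\big)$,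 \item $g((\nabla^g_XE_1)Y,Z)=g(\varphi(E_3Y)^sZ-\varphi(E_3Z)^sY,X)$. \end{itemize}
   Context: A pseudo-Kähler Lie algebra is a triple $(\mathfrak{g},g,J)$ where $\mathfrak{g}$ is a real finite-dimensional Lie algebra, $g$ a non-degenerate symmetric bilinear form of arbitrary signature, $J:\mathfrak{g}\to\mathfrak{g}$ linear with $J^2=-\mathrm{id}$, $g(J\cdot,J\cdot)=g$, and $J$ parallel for the Levi-Civita connection of $g$ (equivalently, $J$ integrable and $\omega=g(J\cdot,\cdot)$ closed). $\nabla^g$ and $\nabla^h$ are the Levi-Civita connections of $(\mathfrak{g},g)$ and $(\mathfrak{h},h)$, given by the Koszul formula $2g(\nabla_XY,Z)=g([X,Y],Z)-g(Y,[X,Z])-g(X,[Y,Z])$; for an endomorphism $E$, $(\nabla_XE)Y=\nabla_X(EY)-E(\nabla_XY)$. $\mathfrak{g}\rtimes_\varphi\mathfrak{h}$ is $\mathfrak{g}\oplus\mathfrak{h}$ with bracket $[X+A,Y+B]=[X,Y]+\varphi(A)Y-\varphi(B)X+[A,B]$; under the stated conditions on $\varphi$, $(\tilde{\mathfrak{g}},\tilde g,\tilde J)$ is pseudo-Kähler. For linear $f:\mathfrak{g}\to\mathfrak{g}$, $f^*$ is the $g$-adjoint, $f^s=\frac12(f+f^* )$, $f^a=\frac12(f-f^* )$. $(\mathfrak{g},g,J,E)$ is an almost hypersymplectic Lie algebra if $(g,J)$ is a pseudo-Kähler structure on $\mathfrak{g}$ and $E\in\mathrm{End}(\mathfrak{g})$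 satisfies $E^2=\mathrm{id}$, $JE=-EJ$ and $g(E\cdot,E\cdot)=-g$. If in addition $E$ is parallel for the Levi-Civita connection of $g$, it is a hypersymplectic Lie algebra. *)

theory Defs
  imports "HOL-Analysis.Analysis"
begin

text \<open>
  The underlying vector space of a Lie algebra is a whole type of class
  \<^class>\<open>real_vector\<close>; finite-dimensionality is a hypothesis on that type.  No norm or
  positive definite inner product is assumed, since the metrics are of arbitrary signature.
\<close>

definition fin_dim_lie_algebra :: "('a::real_vector \<Rightarrow> 'a \<Rightarrow> 'a) \<Rightarrow> bool" where
  "fin_dim_lie_algebra br \<longleftrightarrow>
     (\<exists>S::'a set. finite S \<and> span S = UNIV) \<and>
     bilinear br \<and>
     (\<forall>x. br x x = 0) \<and>
     (\<forall>x y z. br x (br y z) + br y (br z x) + br z (br x y) = 0)"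

definition pseudo_metric :: "('a::real_vector \<Rightarrow> 'a \<Rightarrow> real) \<Rightarrow> bool" where
  "pseudo_metric g \<longleftrightarrow>
     bilinear g \<and>
     (\<forall>x y. g x y = g y x) \<and>
     (\<forall>x. (\<forall>y. g x y = 0) \<longrightarrow> x = 0)"

text \<open>
  The Koszul formula.  The description is proper whenever g is a non-degenerate symmetric bilinear
  form on a finite-dimensional space; likewise for the adjoint below.
\<close>

definition levi_civita ::
  "('a::real_vector \<Rightarrow> 'a \<Rightarrow> 'a) \<Rightarrow> ('a \<Rightarrow> 'a \<Rightarrow> real) \<Rightarrow> 'a \<Rightarrow> 'a \<Rightarrow> 'a" where
  "levi_civita br g X Y =
     (THE W. \<forall>Z. 2 * g W Z = g (br X Y) Z - g Y (br X Z) - g X (br Y Z))"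

definition nabla_endo ::
  "('a::real_vector \<Rightarrow> 'a \<Rightarrow> 'a) \<Rightarrow> ('a \<Rightarrow> 'a \<Rightarrow> real) \<Rightarrow> ('a \<Rightarrow> 'a) \<Rightarrow> 'a \<Rightarrow> 'a \<Rightarrow> 'a" where
  "nabla_endo br g E X Y = levi_civita br g X (E Y) - E (levi_civita br g X Y)"

definition parallel_endo ::
  "('a::real_vector \<Rightarrow> 'a \<Rightarrow> 'a) \<Rightarrow> ('a \<Rightarrow> 'a \<Rightarrow> real) \<Rightarrow> ('a \<Rightarrow> 'a) \<Rightarrow> bool" where
  "parallel_endo br g E \<longleftrightarrow> (\<forall>X Y. nabla_endo br g E X Y = 0)"

definition pseudo_kaehler ::
  "('a::real_vector \<Rightarrow> 'a \<Rightarrow> 'a) \<Rightarrow> ('a \<Rightarrow> 'a \<Rightarrow> real) \<Rightarrow> ('a \<Rightarrow> 'a) \<Rightarrow> bool" where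
  "pseudo_kaehler br g J \<longleftrightarrow>
     fin_dim_lie_algebra br \<and>
     pseudo_metric g \<and>
     linear J \<and>
     (\<forall>x. J (J x) = - x) \<and>
     (\<forall>x y. g (J x) (J y) = g x y) \<and>
     parallel_endo br g J"

definition almost_hypersymplectic ::
  "('a::real_vector \<Rightarrow> 'a \<Rightarrow> 'a) \<Rightarrow> ('a \<Rightarrow> 'a \<Rightarrow> real) \<Rightarrow> ('a \<Rightarrow> 'a) \<Rightarrow> ('a \<Rightarrow> 'a) \<Rightarrow> bool" where
  "almost_hypersymplectic br g J E \<longleftrightarrow>
     pseudo_kaehler br g J \<and>
     linear E \<and>
     (\<forall>x. E (E x) = x) \<and>
     (\<forall>x. J (E x) = - E (J x)) \<and>
     (\<forall>x y. g (E x) (E y) = - g x y)"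

definition hypersymplectic ::
  "('a::real_vector \<Rightarrow> 'a \<Rightarrow> 'a) \<Rightarrow> ('a \<Rightarrow> 'a \<Rightarrow> real) \<Rightarrow> ('a \<Rightarrow> 'a) \<Rightarrow> ('a \<Rightarrow> 'a) \<Rightarrow> bool" where
  "hypersymplectic br g J E \<longleftrightarrow> almost_hypersymplectic br g J E \<and> parallel_endo br g E"

definition metric_adjoint ::
  "('a::real_vector \<Rightarrow> 'a \<Rightarrow> real) \<Rightarrow> ('a \<Rightarrow> 'a) \<Rightarrow> 'a \<Rightarrow> 'a" where
  "metric_adjoint g f = (THE f'. linear f' \<and> (\<forall>x y. g (f x) y = g x (f' y)))"

definition sym_part ::
  "('a::real_vector \<Rightarrow> 'a \<Rightarrow> real) \<Rightarrow> ('a \<Rightarrow> 'a) \<Rightarrow> 'a \<Rightarrow> 'a" where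
  "sym_part g f x = (1/2) *\<^sub>R (f x + metric_adjoint g f x)"

definition skew_part ::
  "('a::real_vector \<Rightarrow> 'a \<Rightarrow> real) \<Rightarrow> ('a \<Rightarrow> 'a) \<Rightarrow> 'a \<Rightarrow> 'a" where
  "skew_part g f x = (1/2) *\<^sub>R (f x - metric_adjoint g f x)"

definition derivation :: "('a::real_vector \<Rightarrow> 'a \<Rightarrow> 'a) \<Rightarrow> ('a \<Rightarrow> 'a) \<Rightarrow> bool" where
  "derivation br D \<longleftrightarrow> linear D \<and> (\<forall>x y. D (br x y) = br (D x) y + br x (D y))"

definition der_representation ::
  "('b::real_vector \<Rightarrow> 'b \<Rightarrow> 'b) \<Rightarrow> ('a::real_vector \<Rightarrow> 'a \<Rightarrow> 'a) \<Rightarrow> ('b \<Rightarrow> 'a \<Rightarrow> 'a) \<Rightarrow> bool" where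
  "der_representation brh brg \<phi> \<longleftrightarrow>
     (\<forall>A. derivation brg (\<phi> A)) \<and>
     (\<forall>X. linear (\<lambda>A. \<phi> A X)) \<and>
     (\<forall>A B X. \<phi> (brh A B) X = \<phi> A (\<phi> B X) - \<phi> B (\<phi> A X))"

definition semidirect_bracket ::
  "('a::real_vector \<Rightarrow> 'a \<Rightarrow> 'a) \<Rightarrow> ('b::real_vector \<Rightarrow> 'b \<Rightarrow> 'b) \<Rightarrow> ('b \<Rightarrow> 'a \<Rightarrow> 'a)
     \<Rightarrow> 'a \<times> 'b \<Rightarrow> 'a \<times> 'b \<Rightarrow> 'a \<times> 'b" where
  "semidirect_bracket brg brh \<phi> = (\<lambda>(X, A) (Y, B). (brg X Y + \<phi> A Y - \<phi> B X, brh A B))"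

definition sum_metric ::
  "('a \<Rightarrow> 'a \<Rightarrow> real) \<Rightarrow> ('b \<Rightarrow> 'b \<Rightarrow> real) \<Rightarrow> 'a \<times> 'b \<Rightarrow> 'a \<times> 'b \<Rightarrow> real" where
  "sum_metric g h = (\<lambda>(X, A) (Y, B). g X Y + h A B)"

definition block_endo ::
  "('a::real_vector \<Rightarrow> 'a) \<Rightarrow> ('b::real_vector \<Rightarrow> 'a) \<Rightarrow> ('a \<Rightarrow> 'b) \<Rightarrow> ('b \<Rightarrow> 'b)
     \<Rightarrow> 'a \<times> 'b \<Rightarrow> 'a \<times> 'b" where
  "block_endo E1 E2 E3 E4 = (\<lambda>(X, A). (E1 X + E2 A, E3 X + E4 A))"

end

theory Submission
  imports Defs
begin

text \<open>
  Let \<open>s(A)\<close> and \<open>k(A)\<close> be the symmetric and the skew part of \<open>\<phi>(A)\<close>.  The Koszul formula shows that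
  the Levi-Civita connection of the semidirect product is made of the two given connections, of
  \<open>k(A)\<close> as the derivative of \<open>\<gg>\<close> in the direction of \<open>A \<in> \<hh>\<close>, and of \<open>s\<close> as a second fundamental
  form coupling the two summands (\<open>levi_civita_semidirect_form\<close>):
  writing \<open>G = g \<oplus> h\<close> and \<open>D\<close>, \<open>D\<^sup>g\<close>, \<open>D\<^sup>h\<close> for the connections of \<open>G\<close>, \<open>g\<close>, \<open>h\<close>, the pairing
  \<open>G(D (X+A) (Y+B), Z+C)\<close> equals
  \<open>g(D\<^sup>g X Y, Z) + g(k(A)Y, Z) - g(s(B)X, Z) + g(s(C)X, Y) + h(D\<^sup>h A B, C)\<close>.

  Being an involution and an anti-isometry, \<open>E\<close> is skew for the metric.  Hence it is parallel if and
  only if the trilinear form \<open>T(P,Q,R) = G(D P (EQ), R) + G(D P Q, ER)\<close> vanishes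
  (\<open>parallel_endo_iff_form\<close>).  Restricting each argument to \<open>\<gg>\<close> or to \<open>\<hh>\<close> splits \<open>T\<close> into
  eight blocks.  As \<open>T\<close> is skew in \<open>Q, R\<close>, two of them repeat others up to sign, and the remaining six
  are exactly the six conditions, once the blocks of \<open>E\<close> are moved across the metrics by
  skewness: \<open>E\<^sub>1\<close> and \<open>E\<^sub>4\<close> are skew and \<open>-E\<^sub>3\<close> is the adjoint of \<open>E\<^sub>2\<close>.

  Non-degeneracy makes it enough to compare scalars.  Together with finite dimension it also ensures
  that the vectors described by the Koszul formula and by the definition of the adjoint exist,
  through the representation of linear functionals by the metric
  (\<open>pseudo_metric_represents_functional\<close>).
\<close>

section \<open>Non-degenerate forms on finite-dimensional spaces\<close>

lemmas bilinear_simps = bilinear_ladd bilinear_radd bilinear_lsub bilinear_rsub bilinear_lmul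
  bilinear_rmul bilinear_lneg bilinear_rneg bilinear_lzero bilinear_rzero

lemma pseudo_metricD:
  assumes "pseudo_metric g"
  shows "bilinear g" "g x y = g y x"
  using assms by (auto simp: pseudo_metric_def)

lemma pseudo_metric_eqI:
  assumes "pseudo_metric g" and "\<And>z. g x z = g y z"
  shows "x = y"
proof -
  have "g (x - y) z = 0" for z
    using assms(2)[of z] by (simp add: bilinear_lsub[OF pseudo_metricD(1)[OF assms(1)]])
  then have "x - y = 0"
    using assms(1) unfolding pseudo_metric_def by blast
  then show ?thesis by simp
qed

lemma pseudo_metric_linearI:
  assumes g: "pseudo_metric g"
    and "\<And>x y z. g (f (x + y)) z = g (f x) z + g (f y) z"
    and "\<And>c x z. g (f (c *\<^sub>R x)) z = c * g (f x) z"
  shows "linear f"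
  by (rule linearI; rule pseudo_metric_eqI[OF g])
    (simp_all add: assms bilinear_simps[OF pseudo_metricD(1)[OF g]])

text \<open>
  On a basis \<open>B\<close>, the map \<open>x \<mapsto> (\<Sum>b\<in>B. g x b *\<^sub>R b)\<close> is an encoding of the map from the space to its dual
  as an endomorphism.  Non-degeneracy makes it injective, and finite dimension makes it onto.
\<close>

lemma pseudo_metric_represents_functional:
  fixes g :: "'a::real_vector \<Rightarrow> 'a \<Rightarrow> real"
  assumes g: "pseudo_metric g" and fin: "\<exists>S::'a set. finite S \<and> span S = UNIV"
    and l: "linear l"
  shows "\<exists>w. \<forall>z. g w z = l z"
proof -
  obtain S :: "'a set" where S: "finite S" "span S = UNIV"
    using fin by blast
  obtain B where B: "B \<subseteq> S" "independent B" "S \<subseteq> span B"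
    by (rule maximal_independent_subset)
  have finB: "finite B" using B(1) S(1) finite_subset by blast
  have spanB: "span B = UNIV"
    using B(3) S(2) span_mono span_span by (metis top.extremum_unique)
  interpret fd: finite_dimensional_vector_space "(*\<^sub>R) :: real \<Rightarrow> 'a \<Rightarrow> 'a" B
    by unfold_locales
      (use finB B(2) spanB in \<open>auto simp: algebra_simps dependent_raw_def span_raw_def\<close>)
  have glin: "linear (g x)" for x
    using pseudo_metricD(1)[OF g] by (simp add: bilinear_def)
  define T where "T x = (\<Sum>b\<in>B. g x b *\<^sub>R b)" for x
  have linT: "linear T"
    unfolding T_def using pseudo_metricD(1)[OF g]
    by (intro linearI) (simp_all add: bilinear_simps scaleR_add_left sum.distrib scaleR_sum_right)
  have agree: "g x z = k z"
    if k: "linear k" and eq: "T x = (\<Sum>b\<in>B. k b *\<^sub>R b)" for x z k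
  proof -
    have "(\<Sum>b\<in>B. (g x b - k b) *\<^sub>R b) = 0"
      using eq by (simp add: T_def scaleR_diff_left sum_subtractf)
    then have "g x b = k b" if "b \<in> B" for b
      using independentD[OF B(2) finB subset_refl, of "\<lambda>b. g x b - k b"] that by auto
    then show ?thesis
      using linear_eq_on_span[OF glin k, of B] spanB by auto
  qed
  have "inj T"
  proof (rule linear_injective_0[OF linT, THEN iffD2], intro allI impI)
    fix x assume "T x = 0"
    then have "g x z = 0" for z
      using agree[of "\<lambda>_. 0" x z] linear_zero by simp
    then show "x = 0"
      using g by (simp add: pseudo_metric_def)
  qed
  then have "surj T"
    using fd.linear_inj_imp_surj linT by (simp add: linear_def)
  then obtain w where "T w = (\<Sum>b\<in>B. l b *\<^sub>R b)"
    by (metis surjD)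
  then show ?thesis
    using agree[OF l] by blast
qed

lemma metric_adjoint_works:
  fixes g :: "'a::real_vector \<Rightarrow> 'a \<Rightarrow> real"
  assumes g: "pseudo_metric g" and fin: "\<exists>S::'a set. finite S \<and> span S = UNIV"
    and f: "linear f"
  shows "linear (metric_adjoint g f)" "g x (metric_adjoint g f y) = g (f x) y"
proof -
  note bl = bilinear_simps[OF pseudo_metricD(1)[OF g]]
  have "\<exists>w. \<forall>x. g w x = g (f x) y" for y
    using pseudo_metric_represents_functional[OF g fin, of "\<lambda>x. g (f x) y"] f
    by (simp add: linear_iff bl)
  then obtain f' where f': "\<And>y x. g (f' y) x = g (f x) y"
    by metis
  have "linear f'"
    by (rule pseudo_metric_linearI[OF g]) (simp_all add: bl f')
  moreover have "g (f x) y = g x (f' y)" for x y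
    using f'[of y x] pseudo_metricD(2)[OF g] by metis
  moreover have "f'' = f'" if "\<forall>x y. g (f x) y = g x (f'' y)" for f''
    by (rule ext, rule pseudo_metric_eqI[OF g]) (metis that f' pseudo_metricD(2)[OF g])
  ultimately have "\<exists>!f'. linear f' \<and> (\<forall>x y. g (f x) y = g x (f' y))"
    by blast
  from theI'[OF this, folded metric_adjoint_def]
  show "linear (metric_adjoint g f)" "g x (metric_adjoint g f y) = g (f x) y"
    by metis+
qed

lemma sym_part_form:
  fixes g :: "'a::real_vector \<Rightarrow> 'a \<Rightarrow> real"
  assumes "pseudo_metric g" "\<exists>S::'a set. finite S \<and> span S = UNIV" "linear f"
  shows "g (sym_part g f x) y = (g (f x) y + g x (f y)) / 2"
proof -
  note bl = bilinear_simps[OF pseudo_metricD(1)[OF assms(1)]]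
  show ?thesis
    using metric_adjoint_works(2)[OF assms, of y x] pseudo_metricD(2)[OF assms(1)]
    by (simp add: sym_part_def bl)
qed

lemma skew_part_form:
  fixes g :: "'a::real_vector \<Rightarrow> 'a \<Rightarrow> real"
  assumes "pseudo_metric g" "\<exists>S::'a set. finite S \<and> span S = UNIV" "linear f"
  shows "g (skew_part g f x) y = (g (f x) y - g x (f y)) / 2"
proof -
  note bl = bilinear_simps[OF pseudo_metricD(1)[OF assms(1)]]
  show ?thesis
    using metric_adjoint_works(2)[OF assms, of y x] pseudo_metricD(2)[OF assms(1)]
    by (simp add: skew_part_def bl)
qed

lemma bilinear_sym_skew_part:
  fixes g :: "'a::real_vector \<Rightarrow> 'a \<Rightarrow> real" and \<phi> :: "'b::real_vector \<Rightarrow> 'a \<Rightarrow> 'a"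
  assumes g: "pseudo_metric g" and fin: "\<exists>S::'a set. finite S \<and> span S = UNIV"
    and \<phi>: "bilinear \<phi>"
  shows "bilinear (\<lambda>A. sym_part g (\<phi> A))" "bilinear (\<lambda>A. skew_part g (\<phi> A))"
proof -
  note bl = bilinear_simps[OF pseudo_metricD(1)[OF g]] bilinear_simps[OF \<phi>]
  have "linear (\<phi> A)" for A
    using \<phi> by (simp add: bilinear_def)
  note form = sym_part_form[OF g fin this] skew_part_form[OF g fin this]
  have "linear (sym_part g (\<phi> A))" for A
    by (rule pseudo_metric_linearI[OF g])
      (simp_all add: bl form algebra_simps add_divide_distrib diff_divide_distrib)
  moreover have "linear (skew_part g (\<phi> A))" for A
    by (rule pseudo_metric_linearI[OF g])
      (simp_all add: bl form algebra_simps add_divide_distrib diff_divide_distrib)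
  moreover have "linear (\<lambda>A. sym_part g (\<phi> A) x)" for x
    by (rule pseudo_metric_linearI[OF g])
      (simp_all add: bl form algebra_simps add_divide_distrib diff_divide_distrib)
  moreover have "linear (\<lambda>A. skew_part g (\<phi> A) x)" for x
    by (rule pseudo_metric_linearI[OF g])
      (simp_all add: bl form algebra_simps add_divide_distrib diff_divide_distrib)
  ultimately show "bilinear (\<lambda>A. sym_part g (\<phi> A))" "bilinear (\<lambda>A. skew_part g (\<phi> A))"
    by (simp_all add: bilinear_def)
qed

section \<open>The Levi-Civita connection of a metric Lie algebra\<close>

lemma levi_civita_koszul:
  fixes g :: "'a::real_vector \<Rightarrow> 'a \<Rightarrow> real"
  assumes br: "fin_dim_lie_algebra br" and g: "pseudo_metric g"
  shows "2 * g (levi_civita br g X Y) Z = g (br X Y) Z - g Y (br X Z) - g X (br Y Z)"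
proof -
  have fin: "\<exists>S::'a set. finite S \<and> span S = UNIV" and "bilinear br"
    using br by (auto simp: fin_dim_lie_algebra_def)
  note bl = bilinear_simps[OF \<open>bilinear br\<close>] bilinear_simps[OF pseudo_metricD(1)[OF g]]
  have "linear (\<lambda>Z. (g (br X Y) Z - g Y (br X Z) - g X (br Y Z)) / 2)"
    by (rule linearI) (simp_all add: bl algebra_simps add_divide_distrib diff_divide_distrib)
  from pseudo_metric_represents_functional[OF g fin this]
  obtain W where "\<And>Z. g W Z = (g (br X Y) Z - g Y (br X Z) - g X (br Y Z)) / 2"
    by blast
  then have W: "2 * g W Z = g (br X Y) Z - g Y (br X Z) - g X (br Y Z)" for Z
    by (simp add: field_simps)
  have "levi_civita br g X Y = W"
    unfolding levi_civita_def
  proof (rule the_equality)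
    fix V assume V: "\<forall>Z. 2 * g V Z = g (br X Y) Z - g Y (br X Z) - g X (br Y Z)"
    have "g V Z = g W Z" for Z
      using V[rule_format, of Z] W[of Z] by simp
    then show "V = W" by (rule pseudo_metric_eqI[OF g])
  qed (simp add: W)
  then show ?thesis by (simp add: W)
qed

lemma levi_civita_bilinear:
  assumes br: "fin_dim_lie_algebra br" and g: "pseudo_metric g"
  shows "bilinear (levi_civita br g)"
proof -
  have "bilinear br"
    using br by (auto simp: fin_dim_lie_algebra_def)
  note bl = bilinear_simps[OF \<open>bilinear br\<close>] bilinear_simps[OF pseudo_metricD(1)[OF g]]
  have form: "g (levi_civita br g X Y) Z = (g (br X Y) Z - g Y (br X Z) - g X (br Y Z)) / 2" for X Y Z
    using levi_civita_koszul[OF br g, of X Y Z] by simp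
  have "linear (levi_civita br g X)" for X
    by (rule pseudo_metric_linearI[OF g])
      (simp_all add: bl form algebra_simps add_divide_distrib diff_divide_distrib)
  moreover have "linear (\<lambda>X. levi_civita br g X Y)" for Y
    by (rule pseudo_metric_linearI[OF g])
      (simp_all add: bl form algebra_simps add_divide_distrib diff_divide_distrib)
  ultimately show ?thesis
    by (simp add: bilinear_def)
qed

lemma lie_bracket_antisym:
  assumes "fin_dim_lie_algebra br"
  shows "br y x = - br x y"
proof -
  have b: "bilinear br" and alt: "\<And>x. br x x = 0"
    using assms by (auto simp: fin_dim_lie_algebra_def)
  have "br x y + br y x = 0"
    using alt[of "x + y"] alt[of x] alt[of y]
    by (simp add: bilinear_ladd[OF b] bilinear_radd[OF b] add.commute)
  then show ?thesis
    by (simp add: add_eq_0_iff)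
qed

text \<open>
  The connection is metric: exchanging \<open>Y\<close> and \<open>Z\<close> in the Koszul formula changes its sign, because the
  bracket is antisymmetric.
\<close>

lemma levi_civita_metric:
  assumes br: "fin_dim_lie_algebra br" and g: "pseudo_metric g"
  shows "g (levi_civita br g X Y) Z = - g Y (levi_civita br g X Z)"
proof -
  have "g X (br Z Y) = - g X (br Y Z)"
    using lie_bracket_antisym[OF br, of Z Y] by (simp add: bilinear_simps[OF pseudo_metricD(1)[OF g]])
  then show ?thesis
    using levi_civita_koszul[OF br g, of X Y Z] levi_civita_koszul[OF br g, of X Z Y]
      pseudo_metricD(2)[OF g, of Y "levi_civita br g X Z"] pseudo_metricD(2)[OF g, of Y "br X Z"]
      pseudo_metricD(2)[OF g, of Z "br X Y"]
    by linarith
qed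

text \<open>
  Pairing the covariant derivative with a test vector loses nothing by non-degeneracy, and
  skewness of \<open>E\<close> moves the outer \<open>E\<close> onto that vector, so that only the connection remains
  to be known.
\<close>

lemma parallel_endo_iff_form:
  assumes g: "pseudo_metric g" and skew: "\<And>x y. g (E x) y = - g x (E y)"
  shows "parallel_endo br g E \<longleftrightarrow>
    (\<forall>X Y Z. g (levi_civita br g X (E Y)) Z + g (levi_civita br g X Y) (E Z) = 0)"
proof -
  note bl = bilinear_simps[OF pseudo_metricD(1)[OF g]]
  have "g (nabla_endo br g E X Y) Z
      = g (levi_civita br g X (E Y)) Z + g (levi_civita br g X Y) (E Z)" for X Y Z
    by (simp add: nabla_endo_def bl skew)
  moreover have "nabla_endo br g E X Y = 0 \<longleftrightarrow> (\<forall>Z. g (nabla_endo br g E X Y) Z = 0)" for X Y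
    using g pseudo_metric_eqI[OF g, of "nabla_endo br g E X Y" 0] by (auto simp: bl)
  ultimately show ?thesis
    by (simp add: parallel_endo_def)
qed

section \<open>The connection of a semidirect product\<close>

text \<open>
  In the Koszul formula the action contributes \<open>g(\<phi>(A)Y, Z) - g(Y, \<phi>(A)Z)\<close>, which is twice the skew part,
  and the symmetric expressions \<open>g(\<phi>(B)X, Z) + g(X, \<phi>(B)Z)\<close> and \<open>g(\<phi>(C)X, Y) + g(X, \<phi>(C)Y)\<close>, which
  are twice the symmetric part and enter with opposite signs.
\<close>

lemma levi_civita_semidirect_form:
  fixes brg :: "'a::real_vector \<Rightarrow> 'a \<Rightarrow> 'a" and brh :: "'b::real_vector \<Rightarrow> 'b \<Rightarrow> 'b"
  assumes G: "fin_dim_lie_algebra brg" "pseudo_metric g"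
    and H: "fin_dim_lie_algebra brh" "pseudo_metric h"
    and S: "fin_dim_lie_algebra (semidirect_bracket brg brh \<phi>)" "pseudo_metric (sum_metric g h)"
    and \<phi>: "bilinear \<phi>"
  shows "sum_metric g h (levi_civita (semidirect_bracket brg brh \<phi>) (sum_metric g h) (X, A) (Y, B)) (Z, C)
    = g (levi_civita brg g X Y) Z + g (skew_part g (\<phi> A) Y) Z - g (sym_part g (\<phi> B) X) Z
      + g (sym_part g (\<phi> C) X) Y + h (levi_civita brh h A B) C"
proof -
  have fin: "\<exists>S::'a set. finite S \<and> span S = UNIV"
    using G by (auto simp: fin_dim_lie_algebra_def)
  have "linear (\<phi> A)" for A
    using \<phi> by (simp add: bilinear_def)
  note form = sym_part_form[OF G(2) fin this] skew_part_form[OF G(2) fin this]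
  note bl = bilinear_simps[OF pseudo_metricD(1)[OF G(2)]]
  show ?thesis
    using levi_civita_koszul[OF S, of "(X, A)" "(Y, B)" "(Z, C)"]
      levi_civita_koszul[OF G, of X Y Z] levi_civita_koszul[OF H, of A B C]
      pseudo_metricD(2)[OF G(2), of Y "\<phi> C X"]
    by (simp only: semidirect_bracket_def sum_metric_def case_prod_conv bl form) argo
qed

theorem theorem4p10:
  fixes brg :: "'a::real_vector \<Rightarrow> 'a \<Rightarrow> 'a"
    and g :: "'a \<Rightarrow> 'a \<Rightarrow> real"
    and Jg :: "'a \<Rightarrow> 'a"
    and brh :: "'b::real_vector \<Rightarrow> 'b \<Rightarrow> 'b"
    and h :: "'b \<Rightarrow> 'b \<Rightarrow> real"
    and Jh :: "'b \<Rightarrow> 'b"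
    and \<phi> :: "'b \<Rightarrow> 'a \<Rightarrow> 'a"
    and E1 :: "'a \<Rightarrow> 'a" and E2 :: "'b \<Rightarrow> 'a" and E3 :: "'a \<Rightarrow> 'b" and E4 :: "'b \<Rightarrow> 'b"
  assumes "pseudo_kaehler brg g Jg"
    and "pseudo_kaehler brh h Jh"
    and "der_representation brh brg \<phi>"
    and "\<And>A. Jg \<circ> sym_part g (\<phi> A) = sym_part g (\<phi> (Jh A))"
    and "\<And>A. Jg \<circ> skew_part g (\<phi> A) = skew_part g (\<phi> A) \<circ> Jg"
    and "linear E1" and "linear E2" and "linear E3" and "linear E4"
    and "almost_hypersymplectic (semidirect_bracket brg brh \<phi>) (sum_metric g h)
           (map_prod Jg Jh) (block_endo E1 E2 E3 E4)"
  shows "hypersymplectic (semidirect_bracket brg brh \<phi>) (sum_metric g h)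
           (map_prod Jg Jh) (block_endo E1 E2 E3 E4) \<longleftrightarrow>
         parallel_endo brh h E4 \<and>
         (\<forall>A. skew_part g (\<phi> A) \<circ> E2 = E2 \<circ> levi_civita brh h A) \<and>
         (\<forall>A. skew_part g (\<phi> A) \<circ> E1 = E1 \<circ> skew_part g (\<phi> A)) \<and>
         (\<forall>B C. sym_part g (\<phi> B) (E2 C) = sym_part g (\<phi> C) (E2 B)) \<and>
         (\<forall>X Y C. g (levi_civita brg g X Y) (E2 C)
                  = g (E1 (sym_part g (\<phi> C) X) - sym_part g (\<phi> (E4 C)) X) Y) \<and>
         (\<forall>X Y Z. g (nabla_endo brg g E1 X Y) Z
                  = g (sym_part g (\<phi> (E3 Y)) Z - sym_part g (\<phi> (E3 Z)) Y) X)"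
proof -
  let ?br = "semidirect_bracket brg brh \<phi>" and ?g = "sum_metric g h"
    and ?E = "block_endo E1 E2 E3 E4"
  have G: "fin_dim_lie_algebra brg" "pseudo_metric g"
    and H: "fin_dim_lie_algebra brh" "pseudo_metric h"
    using assms(1,2) by (auto simp: pseudo_kaehler_def)
  have S: "fin_dim_lie_algebra ?br" "pseudo_metric ?g"
    and EE: "\<And>p. ?E (?E p) = p" and Eg: "\<And>p q. ?g (?E p) (?E q) = - ?g p q"
    using assms(10) by (auto simp: almost_hypersymplectic_def pseudo_kaehler_def)
  have fin: "\<exists>S::'a set. finite S \<and> span S = UNIV"
    using G by (auto simp: fin_dim_lie_algebra_def)
  have \<phi>: "bilinear \<phi>"
    using assms(3) by (auto simp: der_representation_def derivation_def bilinear_def)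
  then have lin\<phi>: "linear (\<phi> A)" for A
    by (simp add: bilinear_def)
  define s k where "s A = sym_part g (\<phi> A)" and "k A = skew_part g (\<phi> A)" for A
  define DG DH where "DG = levi_civita brg g" and "DH = levi_civita brh h"
  have "bilinear s" "bilinear k" "bilinear DG" "bilinear DH"
    unfolding s_def k_def DG_def DH_def
    using bilinear_sym_skew_part[OF G(2) fin \<phi>] levi_civita_bilinear G H by auto
  note bl = this[THEN bilinear_ladd] this[THEN bilinear_radd] this[THEN bilinear_lzero]
    this[THEN bilinear_rzero] bilinear_simps[OF pseudo_metricD(1)[OF G(2)]]
    bilinear_simps[OF pseudo_metricD(1)[OF H(2)]]
    assms(6-9)[THEN linear_0]
  have g_sym: "g x y = g y x" and h_sym: "h u v = h v u" for x y u v
    using G(2) H(2) pseudo_metricD(2) by blast+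

  have s_form: "g (s A X) Y = (g (\<phi> A X) Y + g X (\<phi> A Y)) / 2" for A X Y
    unfolding s_def by (rule sym_part_form[OF G(2) fin lin\<phi>])
  have k_form: "g (k A X) Y = (g (\<phi> A X) Y - g X (\<phi> A Y)) / 2" for A X Y
    unfolding k_def by (rule skew_part_form[OF G(2) fin lin\<phi>])
  have s_sym: "g (s A X) Y = g (s A Y) X" for A X Y
    using g_sym[of X "\<phi> A Y"] g_sym[of Y "\<phi> A X"] by (simp add: s_form)
  have k_skew: "g (k A X) Y = - g (k A Y) X" for A X Y
    using g_sym[of X "\<phi> A Y"] g_sym[of Y "\<phi> A X"] by (simp add: k_form field_simps)
  have DG_skew: "g (DG X Y) Z = - g (DG X Z) Y" for X Y Z
    using levi_civita_metric[OF G] g_sym unfolding DG_def by metis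
  have DH_skew: "h (DH A B) C = - h (DH A C) B" for A B C
    using levi_civita_metric[OF H] h_sym unfolding DH_def by metis

  have E_skew: "?g (?E p) q = - ?g p (?E q)" for p q
    using Eg[of p "?E q"] by (simp add: EE)
  have E1_skew: "g (E1 X) Y = - g X (E1 Y)" for X Y
    using E_skew[of "(X, 0)" "(Y, 0)"] by (simp add: block_endo_def sum_metric_def bl)
  have E2_adj: "g (E2 B) Z = - h B (E3 Z)" for B Z
    using E_skew[of "(0, B)" "(Z, 0)"] by (simp add: block_endo_def sum_metric_def bl)
  have E4_skew: "h (E4 A) B = - h A (E4 B)" for A B
    using E_skew[of "(0, A)" "(0, B)"] by (simp add: block_endo_def sum_metric_def bl)

  (* The blocks of the form (P,Q,R) |-> g((nabla_P E) Q, R): upper case letters at the end of the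
     alphabet run through the ideal, those at its beginning through the complement. *)
  define T1 where "T1 X Y Z
    = g (DG X (E1 Y)) Z + g (DG X Y) (E1 Z) - g (s (E3 Y) X) Z + g (s (E3 Z) X) Y" for X Y Z
  define T2 where "T2 X Y C
    = g (DG X Y) (E2 C) + g (s C X) (E1 Y) + g (s (E4 C) X) Y" for X Y C
  define T3 where "T3 X B C = g (s C X) (E2 B) - g (s B X) (E2 C)" for X B C
  define T4 where "T4 A Y Z = g (k A (E1 Y)) Z + g (k A Y) (E1 Z)" for A Y Z
  define T5 where "T5 A B Z = g (k A (E2 B)) Z + h (DH A B) (E3 Z)" for A B Z
  define T6 where "T6 A B C = h (DH A (E4 B)) C + h (DH A B) (E4 C)" for A B C
  note T_defs = T1_def T2_def T3_def T4_def T5_def T6_def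

  (* The form is skew in its last two slots, so the block (X,B,Z) is minus the block (X,Z,B), and
     (A,Y,C) is minus (A,C,Y): only six of the eight blocks are independent. *)
  have expansion: "?g (levi_civita ?br ?g (X, A) (?E (Y, B))) (Z, C)
      + ?g (levi_civita ?br ?g (X, A) (Y, B)) (?E (Z, C))
    = T1 X Y Z + T2 X Y C - T2 X Z B + T3 X B C + T4 A Y Z + T5 A B Z - T5 A C Y + T6 A B C"
    for X A Y B Z C
  proof -
    have N: "?g (levi_civita ?br ?g (X, A) (Y, B)) (Z, C)
      = g (DG X Y) Z + g (k A Y) Z - g (s B X) Z + g (s C X) Y + h (DH A B) C" for Y B Z C
      using levi_civita_semidirect_form[OF G H S \<phi>] by (simp add: s_def k_def DG_def DH_def)
    have "g (DG X (E2 B)) Z = - g (DG X Z) (E2 B)" "h (DH A (E3 Y)) C = - h (DH A C) (E3 Y)"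
      "g (k A Y) (E2 C) = - g (k A (E2 C)) Y"
      by (rule DG_skew DH_skew k_skew)+
    then show ?thesis
      unfolding block_endo_def case_prod_conv N T_defs by (simp add: bl)
  qed
  have "parallel_endo ?br ?g ?E \<longleftrightarrow> (\<forall>X A Y B Z C.
      T1 X Y Z + T2 X Y C - T2 X Z B + T3 X B C + T4 A Y Z + T5 A B Z - T5 A C Y + T6 A B C = 0)"
    by (simp only: parallel_endo_iff_form[where E = ?E, OF S(2) E_skew] split_paired_All expansion)
  (* Each block is additive in each of its arguments, so setting the other components to 0
     isolates it. *)
  also have "\<dots> \<longleftrightarrow> (\<forall>X Y Z. T1 X Y Z = 0) \<and> (\<forall>X Y C. T2 X Y C = 0) \<and> (\<forall>X B C. T3 X B C = 0)
      \<and> (\<forall>A Y Z. T4 A Y Z = 0) \<and> (\<forall>A B Z. T5 A B Z = 0) \<and> (\<forall>A B C. T6 A B C = 0)"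
    (is "?total \<longleftrightarrow> ?blocks")
  proof
    assume total: ?total
    show ?blocks
    proof (intro conjI allI)
      show "T1 X Y Z = 0" for X Y Z
        using total[rule_format, of X Y Z 0 0 0] by (simp add: T_defs bl)
      show "T2 X Y C = 0" for X Y C
        using total[rule_format, of X Y 0 C 0 0] by (simp add: T_defs bl)
      show "T3 X B C = 0" for X B C
        using total[rule_format, of X 0 0 C B 0] by (simp add: T_defs bl)
      show "T4 A Y Z = 0" for A Y Z
        using total[rule_format, of 0 Y Z 0 0 A] by (simp add: T_defs bl)
      show "T5 A B Z = 0" for A B Z
        using total[rule_format, of 0 0 Z 0 B A] by (simp add: T_defs bl)
      show "T6 A B C = 0" for A B C
        using total[rule_format, of 0 0 0 C B A] by (simp add: T_defs bl)
    qed
  qed simp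
  also have "(\<forall>X Y Z. T1 X Y Z = 0) \<longleftrightarrow> (\<forall>X Y Z. g (nabla_endo brg g E1 X Y) Z
      = g (sym_part g (\<phi> (E3 Y)) Z - sym_part g (\<phi> (E3 Z)) Y) X)"
  proof -
    have "T1 X Y Z = g (nabla_endo brg g E1 X Y) Z - g (s (E3 Y) Z - s (E3 Z) Y) X" for X Y Z
      using s_sym[of "E3 Y" X Z] s_sym[of "E3 Z" X Y]
      by (simp add: T1_def nabla_endo_def DG_def bl E1_skew)
    then show ?thesis
      by (simp add: s_def)
  qed
  also have "(\<forall>X Y C. T2 X Y C = 0) \<longleftrightarrow> (\<forall>X Y C. g (levi_civita brg g X Y) (E2 C)
      = g (E1 (sym_part g (\<phi> C) X) - sym_part g (\<phi> (E4 C)) X) Y)"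
  proof -
    have "T2 X Y C = g (DG X Y) (E2 C) - g (E1 (s C X) - s (E4 C) X) Y" for X Y C
      by (simp add: T2_def bl E1_skew)
    then show ?thesis
      by (simp add: s_def DG_def)
  qed
  also have "(\<forall>X B C. T3 X B C = 0) \<longleftrightarrow>
      (\<forall>B C. sym_part g (\<phi> B) (E2 C) = sym_part g (\<phi> C) (E2 B))"
  proof -
    have "T3 X B C = g (s C (E2 B)) X - g (s B (E2 C)) X" for X B C
      using s_sym[of C X "E2 B"] s_sym[of B X "E2 C"] by (simp add: T3_def)
    then show ?thesis
      using pseudo_metric_eqI[OF G(2)] by (fastforce simp: s_def)
  qed
  also have "(\<forall>A Y Z. T4 A Y Z = 0) \<longleftrightarrow>
      (\<forall>A. skew_part g (\<phi> A) \<circ> E1 = E1 \<circ> skew_part g (\<phi> A))"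
  proof -
    have "T4 A Y Z = g (k A (E1 Y)) Z - g (E1 (k A Y)) Z" for A Y Z
      by (simp add: T4_def E1_skew)
    then show ?thesis
      using pseudo_metric_eqI[OF G(2)] by (fastforce simp: k_def fun_eq_iff)
  qed
  also have "(\<forall>A B Z. T5 A B Z = 0) \<longleftrightarrow>
      (\<forall>A. skew_part g (\<phi> A) \<circ> E2 = E2 \<circ> levi_civita brh h A)"
  proof -
    have "T5 A B Z = g (k A (E2 B)) Z - g (E2 (DH A B)) Z" for A B Z
      by (simp add: T5_def E2_adj)
    then show ?thesis
      using pseudo_metric_eqI[OF G(2)] by (fastforce simp: k_def DH_def fun_eq_iff)
  qed
  also have "(\<forall>A B C. T6 A B C = 0) \<longleftrightarrow> parallel_endo brh h E4"
    by (simp add: parallel_endo_iff_form[where E = E4, OF H(2) E4_skew] T6_def DH_def)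
  finally show ?thesis
    using assms(10) unfolding hypersymplectic_def by blast
qed

end
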